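(* Let $\mathscr{A}$ be an abelian $C^*$-algebra and let $\mathcal{E}$ be a Hilbert $\mathscr{A}$-module. If $T\in L(\mathcal{E})$, then $$\frac{1}{4}\,|||T^*T+TT^*|||\leq(\omega_{o}(T))^2\leq\frac{1}{2}\,|||T^*T+TT^*|||.$$
   Context: A Hilbert $\mathscr{A}$-module $\mathcal{E}$ is a complex linear space and right $\mathscr{A}$-module with an $\mathscr{A}$-valued inner product $\langle\cdot,\cdot\rangle$ satisfying $\langle x,\alpha y+\beta z\rangle=\alpha\langle x,y\rangle+\beta\langle x,z\rangle$, $\langle x,ya\rangle=\langle x,y\rangle a$, $\langle x,y\rangle^*=\langle y,x\rangle$, $\langle x,x\rangle\ge 0$ with equality only if $x=0$ (for $x,y,z\in\mathcal{E}$, $a\in\mathscr{A}$, $\alpha,\beta\in\mathbb{C}$), complete in the norm $\|x\|=\|\langle x,x\rangle\|^{1/2}$. For $x\in\mathcal{E}$ put $|x|=\langle x,x\rangle^{1/2}\in\mathscr{A}$. $L(\mathcal{E})$ denotes the set of adjointable maps on $\mathcal{E}$: maps $T:\mathcal{E}\to\mathcal{E}$ for which there is $T^*:\mathcal{E}\to\mathcal{E}$ with $\langle Tx,y\rangle=\langle x,T^*y\rangle$ for all $x,y\in\mathcal{E}$ (such maps are automatically bounded and $\mathscr{A}$-linear). $\tau(\mathscr{A})$ is the set of characters of $\mathscr{A}$, i.e. nonzero $*$-homomorphisms $\varphi:\mathscr{A}\to\mathbb{C}$. For $T\in L(\mathcal{E})$ define $$|||T|||=\sup\{\varphi(|Tx|):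 x\in\mathcal{E},\ \varphi\in\tau(\mathscr{A}),\ \varphi(|x|)=1\},$$ $$\omega_o(T)=\sup\{|\varphi(\langle Tx,x\rangle)|: x\in\mathcal{E},\ \varphi\in\tau(\mathscr{A}),\ \varphi(|x|)=1\}.$$ If $\mathcal{E}=\{0\}$ these sets are empty and the suprema are taken to be $0$. *)

theory Defs
  imports "HOL-Analysis.Analysis"
begin

class complex_vector = ab_group_add +
  fixes scaleC :: "complex \<Rightarrow> 'a \<Rightarrow> 'a"  (infixr "*\<^sub>C" 75)
  assumes scaleC_add_right: "c *\<^sub>C (x + y) = c *\<^sub>C x + c *\<^sub>C y"
    and scaleC_add_left: "(c + d) *\<^sub>C x = c *\<^sub>C x + d *\<^sub>C x"
    and scaleC_scaleC: "c *\<^sub>C d *\<^sub>C x = (c * d) *\<^sub>C x"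
    and scaleC_one: "1 *\<^sub>C x = x"

(* No unit is assumed: real_normed_algebra does not require one. *)
class cstar_algebra = real_normed_algebra + complete_space + complex_vector +
  fixes star :: "'a \<Rightarrow> 'a"  ("_\<^sup>\<star>" [1000] 999)
  assumes scaleR_scaleC: "r *\<^sub>R x = complex_of_real r *\<^sub>C x"
    and norm_scaleC: "norm (c *\<^sub>C x) = cmod c * norm x"
    and mult_scaleC_left: "(c *\<^sub>C x) * y = c *\<^sub>C (x * y)"
    and mult_scaleC_right: "x * (c *\<^sub>C y) = c *\<^sub>C (x * y)"
    and star_add: "(x + y)\<^sup>\<star> = x\<^sup>\<star> + y\<^sup>\<star>"
    and star_scaleC: "(c *\<^sub>C x)\<^sup>\<star> = cnj c *\<^sub>C x\<^sup>\<star>"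
    and star_mult: "(x * y)\<^sup>\<star> = y\<^sup>\<star> * x\<^sup>\<star>"
    and star_star: "(x\<^sup>\<star>)\<^sup>\<star> = x"
    and cstar_identity: "norm (x\<^sup>\<star> * x) = (norm x)\<^sup>2"

class abelian_cstar_algebra = cstar_algebra + comm_ring

instantiation complex :: abelian_cstar_algebra
begin

definition scaleC_complex :: "complex \<Rightarrow> complex \<Rightarrow> complex" where
  "scaleC_complex c z = c * z"

definition star_complex :: "complex \<Rightarrow> complex" where
  "star_complex z = cnj z"

instance
  by standard
    (auto simp: scaleC_complex_def star_complex_def algebra_simps norm_mult
      power2_eq_square scaleR_conv_of_real)

end

definition positive :: "'a::cstar_algebra \<Rightarrow> bool" where
  "positive a \<longleftrightarrow> (\<exists>b. a = b\<^sup>\<star> * b)"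

(* Meaningful for positive arguments only: these have a unique positive square root. *)
definition positive_sqrt :: "'a::cstar_algebra \<Rightarrow> 'a" where
  "positive_sqrt a = (THE b. positive b \<and> b * b = a)"

definition characters :: "('a::cstar_algebra \<Rightarrow> complex) set" where
  "characters = {\<phi>.
     (\<forall>a b. \<phi> (a + b) = \<phi> a + \<phi> b) \<and>
     (\<forall>c a. \<phi> (c *\<^sub>C a) = c * \<phi> a) \<and>
     (\<forall>a b. \<phi> (a * b) = \<phi> a * \<phi> b) \<and>
     (\<forall>a. \<phi> (a\<^sup>\<star>) = cnj (\<phi> a)) \<and>
     (\<exists>a. \<phi> a \<noteq> 0)}"

definition module_norm :: "('e \<Rightarrow> 'e \<Rightarrow> 'a::cstar_algebra) \<Rightarrow> 'e \<Rightarrow> real" where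
  "module_norm ip x = sqrt (norm (ip x x))"

(* The library's locale module does not apply: it requires a commutative ring with unit.
   Compatibility of the two scalar actions need not be assumed, see
   hilbert_module_scaleC_act below. *)
locale hilbert_module =
  fixes act :: "'e::complex_vector \<Rightarrow> 'a::cstar_algebra \<Rightarrow> 'e"
    and ip :: "'e \<Rightarrow> 'e \<Rightarrow> 'a"
  assumes act_add_left: "act (x + y) a = act x a + act y a"
    and act_add_right: "act x (a + b) = act x a + act x b"
    and act_mult: "act x (a * b) = act (act x a) b"
    and ip_linear: "ip x (\<alpha> *\<^sub>C y + \<beta> *\<^sub>C z) = \<alpha> *\<^sub>C ip x y + \<beta> *\<^sub>C ip x z"
    and ip_act: "ip x (act y a) = ip x y * a"
    and ip_star: "(ip x y)\<^sup>\<star> = ip y x"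
    and ip_positive: "positive (ip x x)"
    and ip_definite: "ip x x = 0 \<Longrightarrow> x = 0"
    and complete: "(\<forall>e>0. \<exists>N. \<forall>m\<ge>N. \<forall>n\<ge>N. module_norm ip (X m - X n) < e) \<Longrightarrow>
      \<exists>l. (\<lambda>n. module_norm ip (X n - l)) \<longlonglongrightarrow> 0"

lemma hilbert_module_scaleC_act:
  assumes "hilbert_module act ip"
  shows "c *\<^sub>C act x a = act (c *\<^sub>C x) a" and "c *\<^sub>C act x a = act x (c *\<^sub>C a)"
proof -
  interpret hilbert_module act ip by fact
  have add: "ip u (v + w) = ip u v + ip u w" for u v w
    using ip_linear[of u 1 v 1 w] by (simp add: scaleC_one)
  have zero: "0 *\<^sub>C v = 0" for v :: 'b
    using scaleC_add_left[of 0 0 v] by simp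
  have zero': "0 *\<^sub>C v = 0" for v :: 'a
    using scaleC_add_left[of 0 0 v] by simp
  have scale: "ip u (c *\<^sub>C v) = c *\<^sub>C ip u v" for u v c
    using ip_linear[of u c v 0 v] by (simp add: zero zero')
  have eq: "v = w" if "\<And>u. ip u v = ip u w" for v w
  proof -
    have "ip (v - w) v = ip (v - w) (v - w) + ip (v - w) w"
      using add[of "v - w" "v - w" w] by simp
    then have "ip (v - w) (v - w) = 0" using that by simp
    then show ?thesis using ip_definite by fastforce
  qed
  show "c *\<^sub>C act x a = act (c *\<^sub>C x) a"
    by (rule eq) (simp add: scale ip_act mult_scaleC_left)
  show "c *\<^sub>C act x a = act x (c *\<^sub>C a)"
    by (rule eq) (simp add: scale ip_act mult_scaleC_right)
qed

definition module_abs :: "('e \<Rightarrow> 'e \<Rightarrow> 'a::cstar_algebra) \<Rightarrow> 'e \<Rightarrow> 'a" where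
  "module_abs ip x = positive_sqrt (ip x x)"

definition adjointable :: "('e \<Rightarrow> 'e \<Rightarrow> 'a) \<Rightarrow> ('e \<Rightarrow> 'e) set" where
  "adjointable ip = {T. \<exists>S. \<forall>x y. ip (T x) y = ip x (S y)}"

definition adj :: "('e \<Rightarrow> 'e \<Rightarrow> 'a) \<Rightarrow> ('e \<Rightarrow> 'e) \<Rightarrow> ('e \<Rightarrow> 'e)" where
  "adj ip T = (THE S. \<forall>x y. ip (T x) y = ip x (S y))"

(* The supremum of the empty set is 0 by convention; Sup {} is unspecified in type real. *)
definition sup0 :: "real set \<Rightarrow> real" where
  "sup0 S = (if S = {} then 0 else Sup S)"

(* A character takes real values on positive elements, so Re only changes the type here. *)
definition triple_norm ::
  "('e \<Rightarrow> 'e \<Rightarrow> 'a::cstar_algebra) \<Rightarrow> ('e \<Rightarrow> 'e) \<Rightarrow> real" where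
  "triple_norm ip T =
     sup0 {Re (\<phi> (module_abs ip (T x))) | x \<phi>.
       \<phi> \<in> characters \<and> \<phi> (module_abs ip x) = 1}"

definition omega_o ::
  "('e \<Rightarrow> 'e \<Rightarrow> 'a::cstar_algebra) \<Rightarrow> ('e \<Rightarrow> 'e) \<Rightarrow> real" where
  "omega_o ip T =
     sup0 {cmod (\<phi> (ip (T x) x)) | x \<phi>.
       \<phi> \<in> characters \<and> \<phi> (module_abs ip x) = 1}"

end

theory Submission
  imports Defs
begin

text \<open>A character \<open>\<phi>\<close> turns the module into a semi-inner product space with \<open>[x, y] = \<phi> (ip x y)\<close>,
  whose seminorm of \<open>x\<close> is \<open>\<phi> |x|\<close>, and Kittaneh's argument applies there. Let \<open>S\<close> be the adjoint of
  \<open>T\<close>, \<open>T = H + \<i> K\<close> with selfadjoint \<open>H\<close>, \<open>K\<close>, and \<open>P = S T + T S = 2 (H\<^sup>2 + K\<^sup>2)\<close>. The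
  numerical radius \<open>w\<close> of \<open>T\<close> bounds those of \<open>H\<close> and \<open>K\<close>, hence their seminorms, so that \<open>P\<close> has
  seminorm at most \<open>4 w\<^sup>2\<close>. Conversely \<open>2 |[T x, x]|\<^sup>2 \<le> [T x, T x] + [S x, S x] = [P x, x]\<close> for unit \<open>x\<close>.

  The identity \<open>\<phi> |x| = sqrt [x, x]\<close> requires unique positive square roots in the algebra, and
  finiteness of the suprema requires a bound for \<open>T\<close> that is uniform in \<open>\<phi>\<close>.\<close>

section \<open>Square roots in abelian C*-algebras\<close>

instance cstar_algebra \<subseteq> banach ..

lemma scaleC_0_left [simp]: "0 *\<^sub>C (x::'a::complex_vector) = 0"
  using scaleC_add_left[of 0 0 x] by simp

lemma scaleC_minus_one [simp]: "(- 1) *\<^sub>C (x::'a::complex_vector) = - x"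
  using scaleC_add_left[of "-1" 1 x] by (simp add: scaleC_one eq_neg_iff_add_eq_0)

lemma scaleC_minus_right [simp]: "c *\<^sub>C (- x) = - (c *\<^sub>C (x::'a::complex_vector))"
  by (metis mult.commute scaleC_minus_one scaleC_scaleC)

lemma star_0 [simp]: "(0::'a::cstar_algebra)\<^sup>\<star> = 0"
  using star_add[of 0 "0::'a"] by simp

lemma star_minus [simp]: "(- x)\<^sup>\<star> = - (x::'a::cstar_algebra)\<^sup>\<star>"
  using star_add[of x "-x"] by (simp add: eq_neg_iff_add_eq_0 add.commute)

lemma star_diff: "(x - y)\<^sup>\<star> = x\<^sup>\<star> - (y::'a::cstar_algebra)\<^sup>\<star>"
  using star_add[of x "-y"] by simp

lemma star_scaleR: "(r *\<^sub>R x)\<^sup>\<star> = r *\<^sub>R (x::'a::cstar_algebra)\<^sup>\<star>"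
  by (simp add: scaleR_scaleC star_scaleC)

text \<open>The C*-identity and submultiplicativity give
  \<open>norm y \<le> norm (y\<^sup>\<star>)\<close>; applying this to \<open>x\<close> and to
  \<open>x\<^sup>\<star>\<close> gives equality.\<close>

lemma norm_star [simp]: "norm (x\<^sup>\<star>) = norm (x::'a::cstar_algebra)"
proof -
  have le: "norm y \<le> norm (y\<^sup>\<star>)" for y :: 'a
  proof (cases "y = 0")
    case False
    have "norm y * norm y \<le> norm (y\<^sup>\<star>) * norm y"
      using cstar_identity[of y] norm_mult_ineq[of "y\<^sup>\<star>" y] by (simp add: power2_eq_square)
    with False show ?thesis by simp
  qed simp
  show ?thesis using le[of x] le[of "x\<^sup>\<star>"] by (simp add: star_star)
qed

lemma bounded_linear_star: "bounded_linear (star :: 'a \<Rightarrow> 'a::cstar_algebra)"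
  by (rule bounded_linear_intro[where K=1]) (auto simp: star_add star_scaleR)

text \<open>Taking \<open>z = x\<^sup>\<star>\<close> makes the left side
  \<open>(norm x)\<^sup>2\<close>. Bounds on multiplication operators thus become bounds on
  elements, which stands in for evaluation at a unit.\<close>

lemma norm_le_if_mult_le:
  fixes x :: "'a::cstar_algebra"
  assumes "\<And>z. norm (x * z) \<le> K * norm z" "0 \<le> K"
  shows "norm x \<le> K"
proof (cases "x = 0")
  case False
  have "norm (x\<^sup>\<star>) * norm (x\<^sup>\<star>) \<le> K * norm (x\<^sup>\<star>)"
    using assms(1)[of "x\<^sup>\<star>"] cstar_identity[of "x\<^sup>\<star>"] by (simp add: star_star power2_eq_square)
  with False show ?thesis by simp
qed (simp add: assms)

section \<open>Square roots by a majorized iteration\<close>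

primrec majorant :: "nat \<Rightarrow> real" where
  "majorant 0 = 0"
| "majorant (Suc n) = (1 + (majorant n)\<^sup>2) / 2"

lemma majorant_bounds: "0 \<le> majorant n" "majorant n \<le> 1"
proof (induction n)
  case (Suc n)
  { case 1 show ?case by simp }
  { case 2 show ?case using Suc by (simp add: power_le_one) }
qed auto

lemma majorant_mono: "majorant n \<le> majorant (Suc n)"
  using zero_le_power2[of "majorant n - 1"] by (simp add: power2_eq_square algebra_simps)

text \<open>A bounded increasing sequence converges, and 1 is the only fixed point of the recursion,
  as a double root.\<close>

lemma majorant_LIMSEQ: "majorant \<longlonglongrightarrow> 1"
proof -
  have "incseq majorant" using majorant_mono by (rule incseq_SucI)
  then obtain L where L: "majorant \<longlonglongrightarrow> L"
    using incseq_convergent[of majorant 1] majorant_bounds by metis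
  have "(\<lambda>n. majorant (Suc n)) \<longlonglongrightarrow> (1 + L\<^sup>2) / 2"
    unfolding majorant.simps by (intro tendsto_intros L) auto
  then have "L = (1 + L\<^sup>2) / 2" using LIMSEQ_Suc[OF L] LIMSEQ_unique by blast
  then have "(L - 1)\<^sup>2 = 0" by (simp add: power2_eq_square algebra_simps)
  with L show ?thesis by simp
qed

text \<open>In the unitization put \<open>r = \<rho> - a\<close>, so that \<open>norm r \<le> 1\<close>. The iteration
  \<open>y \<mapsto> (r + y\<^sup>2) / 2\<close> from \<open>0\<close> converges to \<open>1 - sqrt (1 - r)\<close>, and its increments are
  dominated by those of the scalar iteration for \<open>r = 1\<close>, since it is a polynomial in \<open>r\<close> with
  nonnegative coefficients. The part of \<open>y\<close> in the algebra is recorded by \<open>y = \<rho> * majorant n - root_iter \<rho> a n\<close>,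
  which avoids adjoining a unit; it needs \<open>\<rho>\<^sup>2 = \<rho>\<close>.\<close>

primrec root_iter :: "real \<Rightarrow> 'a \<Rightarrow> nat \<Rightarrow> 'a::abelian_cstar_algebra" where
  "root_iter \<rho> a 0 = 0"
| "root_iter \<rho> a (Suc n) = (1/2) *\<^sub>R (a + (2 * \<rho> * majorant n) *\<^sub>R root_iter \<rho> a n
     - root_iter \<rho> a n * root_iter \<rho> a n)"

text \<open>For \<open>\<rho> = 1\<close> the equation reads \<open>v * v = a\<close>; for
  \<open>\<rho> = 0\<close> it reads \<open>(1 + v)\<^sup>2 = 1 + a\<close> in the unitization. The
  final bound is the hypothesis again, now for \<open>v\<close>, so that a root of the root can be
  taken.\<close>

lemma one_minus_root:
  fixes a :: "'a::abelian_cstar_algebra"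
  assumes a: "a\<^sup>\<star> = a" and \<rho>: "\<rho> = 0 \<or> \<rho> = 1"
    and bound: "\<And>z. norm (\<rho> *\<^sub>R z - a * z) \<le> norm z"
  obtains v where "v\<^sup>\<star> = v" "2 *\<^sub>R v = a + (2 * \<rho>) *\<^sub>R v - v * v"
    "\<And>z. norm (\<rho> *\<^sub>R z - v * z) \<le> norm z"
proof -
  define v where "v = root_iter \<rho> a"
  define t where "t = majorant"
  \<comment> \<open>The iterate is kept as a multiplication operator on the algebra, so that it can
    be estimated there even with its scalar part.\<close>
  define y where "y n z = (\<rho> * t n) *\<^sub>R z - v n * z" for n z
  have v_Suc: "v (Suc n) = (1/2) *\<^sub>R (a + (2 * \<rho> * t n) *\<^sub>R v n - v n * v n)" for n
    by (simp add: v_def t_def)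
  have t: "0 \<le> t n" "t n \<le> 1" "t n \<le> t (Suc n)" "t (Suc n) = (1 + t n * t n) / 2" for n
    using majorant_bounds majorant_mono by (auto simp: t_def power2_eq_square simp del: majorant.simps(2))
      (simp add: power2_eq_square)
  have star_v: "(v n)\<^sup>\<star> = v n" for n
    by (induction n)
      (simp_all add: v_Suc star_scaleR star_add star_diff star_mult a, simp add: v_def)
  have y_Suc: "y (Suc n) z = (1/2) *\<^sub>R ((\<rho> *\<^sub>R z - a * z) + y n (y n z))" for n z
  proof -
    define x where "x = a + (2 * \<rho> * t n) *\<^sub>R v n - v n * v n"
    have v_x: "v (Suc n) = (1/2) *\<^sub>R x" by (simp add: x_def v_Suc)
    have "y n (y n z) = (\<rho> * t n * (\<rho> * t n)) *\<^sub>R z - (2 * (\<rho> * t n)) *\<^sub>R (v n * z) + v n * v n * z"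
      unfolding mult_2 scaleR_add_left by (simp add: y_def scaleR_diff_right right_diff_distrib mult.assoc)
    moreover have "\<rho> + \<rho> * t n * (\<rho> * t n) = 2 * (\<rho> * t (Suc n))"
      using \<rho> t(4)[of n] by (auto simp: field_simps)
    then have "(2 * (\<rho> * t (Suc n))) *\<^sub>R z = \<rho> *\<^sub>R z + (\<rho> * t n * (\<rho> * t n)) *\<^sub>R z"
      by (metis scaleR_add_left)
    ultimately have "(\<rho> *\<^sub>R z - a * z) + y n (y n z) = (2 * (\<rho> * t (Suc n))) *\<^sub>R z - x * z"
      by (simp add: x_def distrib_right left_diff_distrib mult.assoc)
    then show ?thesis by (simp add: y_def v_x scaleR_diff_right)
  qed
  have y_diff: "y n (x - z) = y n x - y n z" for n x z
    by (simp add: y_def algebra_simps)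
  have y_bound: "norm (y n z) \<le> t n * norm z" for n z
  proof (induction n arbitrary: z)
    case 0
    show ?case by (simp add: y_def v_def t_def)
  next
    case (Suc n)
    have "norm (y n (y n z)) \<le> t n * (t n * norm z)"
      using Suc[of "y n z"] mult_left_mono[OF Suc[of z], of "t n"] t(1)[of n] by linarith
    then have "norm ((\<rho> *\<^sub>R z - a * z) + y n (y n z)) \<le> norm z + t n * (t n * norm z)"
      using bound[of z] norm_triangle_ineq[of "\<rho> *\<^sub>R z - a * z" "y n (y n z)"] by linarith
    then show ?case unfolding y_Suc t(4)[of n] norm_scaleR by (simp add: field_simps)
  qed
  have y_step: "norm (y (Suc n) z - y n z) \<le> (t (Suc n) - t n) * norm z" for n z
  proof (induction n arbitrary: z)
    case 0
    show ?case using bound[of z] by (simp add: y_Suc) (simp add: y_def v_def t_def)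
  next
    case (Suc n)
    let ?d = "t (Suc n) - t n"
    have "y (Suc (Suc n)) z - y (Suc n) z
        = (1/2) *\<^sub>R (y (Suc n) (y (Suc n) z) - y n (y n z))"
      unfolding y_Suc[of "Suc n"] y_Suc[of n z] by (simp add: algebra_simps)
    \<comment> \<open>A difference of squares is split as
      \<open>q\<^sup>2 - p\<^sup>2 = q (q - p) + (q - p) p\<close>. The scalars \<open>t\<close>
      satisfy the same identity, so the induction closes.\<close>
    also have "y (Suc n) (y (Suc n) z) - y n (y n z)
        = y (Suc n) (y (Suc n) z - y n z) + (y (Suc n) (y n z) - y n (y n z))"
      by (simp add: y_diff)
    finally have eq: "y (Suc (Suc n)) z - y (Suc n) z
        = (1/2) *\<^sub>R (y (Suc n) (y (Suc n) z - y n z) + (y (Suc n) (y n z) - y n (y n z)))" .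
    have 1: "norm (y (Suc n) (y (Suc n) z - y n z)) \<le> t (Suc n) * (?d * norm z)"
      using y_bound[of "Suc n" "y (Suc n) z - y n z"]
        mult_left_mono[OF Suc[of z] t(1)[of "Suc n"]] by linarith
    have 2: "norm (y (Suc n) (y n z) - y n (y n z)) \<le> ?d * (t n * norm z)"
      using Suc[of "y n z"] mult_left_mono[OF y_bound[of n z], of ?d] t(3)[of n] by linarith
    have "norm (y (Suc (Suc n)) z - y (Suc n) z)
        \<le> (t (Suc n) * (?d * norm z) + ?d * (t n * norm z)) / 2"
      unfolding eq using 1 2 norm_triangle_ineq[of "y (Suc n) (y (Suc n) z - y n z)"
          "y (Suc n) (y n z) - y n (y n z)"] by simp
    also have "\<dots> = (t (Suc (Suc n)) - t (Suc n)) * norm z"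
      unfolding t(4)[of "Suc n"] using t(4)[of n] by (simp add: field_simps)
    finally show ?case .
  qed
  \<comment> \<open>One increment of \<open>t\<close> comes from the scalar part, the other from
    \<open>y\<close>.\<close>
  have v_step: "norm (v (Suc n) - v n) \<le> 2 * (t (Suc n) - t n)" for n
  proof (rule norm_le_if_mult_le)
    fix z :: 'a
    have "(v (Suc n) - v n) * z = (\<rho> * (t (Suc n) - t n)) *\<^sub>R z - (y (Suc n) z - y n z)"
      by (simp add: y_def algebra_simps)
    then have "norm ((v (Suc n) - v n) * z)
        \<le> norm ((\<rho> * (t (Suc n) - t n)) *\<^sub>R z) + norm (y (Suc n) z - y n z)"
      by (simp only: norm_triangle_ineq4)
    also have "norm ((\<rho> * (t (Suc n) - t n)) *\<^sub>R z) \<le> (t (Suc n) - t n) * norm z"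
      using \<rho> t(3)[of n] by auto
    also note y_step[of n z]
    finally show "norm ((v (Suc n) - v n) * z) \<le> 2 * (t (Suc n) - t n) * norm z"
      by (simp add: algebra_simps)
  qed (use t(3) in simp)
  have t_lim: "t \<longlonglongrightarrow> 1" by (simp add: t_def majorant_LIMSEQ)
  \<comment> \<open>The bounds form a convergent telescoping series, so completeness yields a limit
    of \<open>v\<close>.\<close>
  have "summable (\<lambda>n. v (Suc n) - v n)"
    using summable_mult[OF telescope_summable[OF t_lim], of 2] v_step
    by (rule summable_comparison_test')
  then have "(\<lambda>n. \<Sum>k<n. v (Suc k) - v k) \<longlonglongrightarrow> (\<Sum>k. v (Suc k) - v k)"
    by (rule summable_LIMSEQ)
  moreover have "(\<lambda>n. \<Sum>k<n. v (Suc k) - v k) = v"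
    by (rule ext, subst sum_lessThan_telescope) (simp add: v_def)
  ultimately obtain u where u: "v \<longlonglongrightarrow> u" by metis
  show ?thesis
  proof
    have "(\<lambda>n. (v n)\<^sup>\<star>) \<longlonglongrightarrow> u\<^sup>\<star>" by (rule bounded_linear.tendsto[OF bounded_linear_star u])
    then show "u\<^sup>\<star> = u" using u LIMSEQ_unique by (auto simp: star_v)
    have "(\<lambda>n. v (Suc n)) \<longlonglongrightarrow> (1/2) *\<^sub>R (a + (2 * \<rho> * 1) *\<^sub>R u - u * u)"
      unfolding v_Suc by (intro tendsto_intros u t_lim)
    then have "u = (1/2) *\<^sub>R (a + (2 * \<rho> * 1) *\<^sub>R u - u * u)"
      using LIMSEQ_Suc[OF u] LIMSEQ_unique by blast
    then have "2 *\<^sub>R u = 2 *\<^sub>R ((1/2) *\<^sub>R (a + (2 * \<rho>) *\<^sub>R u - u * u))"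
      unfolding mult_1_right by (rule arg_cong)
    then show "2 *\<^sub>R u = a + (2 * \<rho>) *\<^sub>R u - u * u" by simp
    fix z
    have lim: "(\<lambda>n. norm (y n z)) \<longlonglongrightarrow> norm ((\<rho> * 1) *\<^sub>R z - u * z)"
      unfolding y_def by (intro tendsto_intros u t_lim)
    have "norm (y n z) \<le> norm z" for n
      using y_bound[of n z] mult_right_mono[OF t(2)[of n] norm_ge_zero[of z]] by simp
    then have "norm ((\<rho> * 1) *\<^sub>R z - u * z) \<le> norm z"
      by (intro Lim_bounded[OF lim, of 0]) simp
    then show "norm (\<rho> *\<^sub>R z - u * z) \<le> norm z" by simp
  qed
qed

text \<open>In the unitization the equation reads \<open>1 - a = (1 - w)\<^sup>2\<close>. It is the
  case \<open>\<rho> = 0\<close> of \<open>one_minus_root\<close> for \<open>- a\<close>, with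
  \<open>w = - v\<close>.\<close>

lemma one_minus_eq_square:
  fixes a :: "'a::abelian_cstar_algebra"
  assumes a: "a\<^sup>\<star> = a" "norm a \<le> 1"
  obtains w where "w\<^sup>\<star> = w" "w + w = a + w * w"
proof -
  have "norm (0 *\<^sub>R z - (- a) * z) \<le> norm z" for z
    using norm_mult_ineq[of a z] mult_right_mono[OF a(2) norm_ge_zero[of z]] by simp
  then obtain v where v: "v\<^sup>\<star> = v" "2 *\<^sub>R v = - a + (2 * 0) *\<^sub>R v - v * v"
    by (rule one_minus_root[rotated 2]) (simp_all add: a)
  have "v + v = - a - v * v" using v(2) by (simp add: scaleR_2)
  then have "- v + - v = a + (- v) * (- v)"
    by (metis minus_add_distrib minus_diff_eq minus_mult_minus diff_minus_eq_add
        uminus_add_conv_diff add.commute)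
  then show ?thesis using that[of "- v"] v(1) by simp
qed

lemma norm_eq_if_star_mult_eq:
  fixes x :: "'a::cstar_algebra"
  shows "x\<^sup>\<star> * x = y\<^sup>\<star> * y \<Longrightarrow> norm x = norm y"
  by (metis cstar_identity norm_ge_zero power2_eq_imp_eq)

lemma selfadjoint_decomposition:
  fixes b :: "'a::cstar_algebra"
  obtains h k where "h\<^sup>\<star> = h" "k\<^sup>\<star> = k" "b = h + \<i> *\<^sub>C k" "norm h \<le> norm b" "norm k \<le> norm b"
proof
  let ?h = "(1/2) *\<^sub>C (b + b\<^sup>\<star>)"
  let ?k = "(-\<i>/2) *\<^sub>C (b + (-1) *\<^sub>C b\<^sup>\<star>)"
  show "?h\<^sup>\<star> = ?h" by (simp add: star_scaleC star_add star_star add.commute)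
  show "?k\<^sup>\<star> = ?k"
    by (simp only: star_scaleC star_add star_star scaleC_add_right scaleC_scaleC) (simp add: add.commute)
  have "?h + \<i> *\<^sub>C ?k = (1/2) *\<^sub>C b + (1/2) *\<^sub>C b + ((1/2) *\<^sub>C b\<^sup>\<star> + (-1/2) *\<^sub>C b\<^sup>\<star>)"
    by (simp only: scaleC_add_right scaleC_scaleC) simp
  also have "\<dots> = b"
    by (simp only: scaleC_add_left[symmetric]) (simp add: scaleC_one)
  finally show "b = ?h + \<i> *\<^sub>C ?k" by simp
  show "norm ?h \<le> norm b"
    using norm_triangle_ineq[of b "b\<^sup>\<star>"] by (simp add: norm_scaleC norm_divide)
  show "norm ?k \<le> norm b"
    using norm_triangle_ineq4[of b "b\<^sup>\<star>"] by (simp add: norm_scaleC norm_divide)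
qed

text \<open>The two cross terms carry the factors \<open>\<i>\<close> and \<open>- \<i>\<close> and
  cancel by the hypothesis. This writes a sum of two squares in the form required by
  \<open>positive\<close>.\<close>

lemma star_mult_complex_combination:
  fixes p q :: "'a::cstar_algebra"
  assumes "p\<^sup>\<star> * q = q\<^sup>\<star> * p"
  shows "(p + \<i> *\<^sub>C q)\<^sup>\<star> * (p + \<i> *\<^sub>C q) = p\<^sup>\<star> * p + q\<^sup>\<star> * q"
proof -
  have "(p + \<i> *\<^sub>C q)\<^sup>\<star> = p\<^sup>\<star> + (-\<i>) *\<^sub>C q\<^sup>\<star>" by (simp add: star_add star_scaleC)
  moreover have "(p\<^sup>\<star> + (-\<i>) *\<^sub>C q\<^sup>\<star>) * (p + \<i> *\<^sub>C q)
      = p\<^sup>\<star> * p + q\<^sup>\<star> * q + (\<i> *\<^sub>C (p\<^sup>\<star> * q) + (-\<i>) *\<^sub>C (p\<^sup>\<star> * q))"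
    by (simp add: distrib_left distrib_right mult_scaleC_left mult_scaleC_right scaleC_scaleC
        scaleC_add_right scaleC_one assms)
  ultimately show ?thesis by (simp only: scaleC_add_left[symmetric]) simp
qed

text \<open>With \<open>1 - h\<^sup>2 = (1 - w)\<^sup>2\<close>, the elements \<open>(1 - w \<plusminus> \<i> h) z\<close> have the norm of \<open>z\<close> by the
  C*-identity, and \<open>(1 - w) z\<close> is their mean.\<close>

lemma norm_diff_square_mult_le:
  fixes h z :: "'a::abelian_cstar_algebra"
  assumes h: "h\<^sup>\<star> = h" "norm h \<le> 1"
  shows "norm (z - h * h * z) \<le> norm z"
proof -
  have "norm (h * h) \<le> 1" using cstar_identity[of h] h by (simp add: power_le_one)
  moreover have "(h * h)\<^sup>\<star> = h * h" by (simp add: star_mult h)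
  ultimately obtain w where w: "w\<^sup>\<star> = w" "w + w = h * h + w * w"
    by (metis one_minus_eq_square)
  have le: "norm (z - w * z) \<le> norm z" for z
  proof -
    let ?q = "z - w * z"
    let ?p = "\<i> *\<^sub>C (h * z)"
    have expand: "(?q + ?p)\<^sup>\<star> * (?q + ?p) = z\<^sup>\<star> * z" "(?q - ?p)\<^sup>\<star> * (?q - ?p) = z\<^sup>\<star> * z"
    proof -
      have *: "?q\<^sup>\<star> = z\<^sup>\<star> - w * z\<^sup>\<star>" "(h * z)\<^sup>\<star> = h * z\<^sup>\<star>"
        by (simp_all add: star_diff star_mult w h mult.commute)
      have "?q\<^sup>\<star> * ?q + (h * z)\<^sup>\<star> * (h * z) = z\<^sup>\<star> * z + z\<^sup>\<star> * z * (h * h + w * w - (w + w))"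
        unfolding * by (simp add: algebra_simps)
      then have sum: "?q\<^sup>\<star> * ?q + (h * z)\<^sup>\<star> * (h * z) = z\<^sup>\<star> * z" by (simp add: w(2))
      have "?q\<^sup>\<star> * (h * z) = (h * z)\<^sup>\<star> * ?q" unfolding * by (simp add: algebra_simps)
      then show "(?q + ?p)\<^sup>\<star> * (?q + ?p) = z\<^sup>\<star> * z" "(?q - ?p)\<^sup>\<star> * (?q - ?p) = z\<^sup>\<star> * z"
        using star_mult_complex_combination[of ?q "h * z"]
          star_mult_complex_combination[of ?q "- (h * z)"] sum by simp_all
    qed
    have "norm (?q + ?p) = norm z" "norm (?q - ?p) = norm z"
      using expand by (blast intro: norm_eq_if_star_mult_eq)+
    moreover have "2 *\<^sub>R ?q = (?q + ?p) + (?q - ?p)" by (simp add: scaleR_2)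
    ultimately have "norm (2 *\<^sub>R ?q) \<le> norm z + norm z" by (metis norm_triangle_ineq)
    then show ?thesis by simp
  qed
  have "h * h = w + w - w * w" using w(2) by (simp add: algebra_simps)
  then have "h * h * z = w * z + w * z - w * (w * z)"
    by (simp add: distrib_right left_diff_distrib mult.assoc)
  then have "z - h * h * z = (z - w * z) - w * (z - w * z)"
    by (simp add: right_diff_distrib)
  then show ?thesis using le[of "z - w * z"] le[of z] by (metis order_trans)
qed

section \<open>Positive elements: roots, sums and order\<close>

lemma positive_square:
  fixes p :: "'a::cstar_algebra"
  shows "p\<^sup>\<star> = p \<Longrightarrow> positive (p * p)"
  unfolding positive_def by metis

lemma positive_sqrt_exists:
  fixes a :: "'a::abelian_cstar_algebra"
  assumes "positive a"
  obtains v where "positive v" "v * v = a"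
proof -
  obtain b where b: "a = b\<^sup>\<star> * b" using assms by (auto simp: positive_def)
  obtain h k where hk: "h\<^sup>\<star> = h" "k\<^sup>\<star> = k" "b = h + \<i> *\<^sub>C k" "norm h \<le> norm b" "norm k \<le> norm b"
    by (rule selfadjoint_decomposition)
  have a: "a = h * h + k * k"
    using star_mult_complex_combination[of h k] by (simp add: b hk mult.commute)
  \<comment> \<open>The factor brings the real and imaginary parts of \<open>b\<close> into the unit
    ball, also when \<open>b = 0\<close>.\<close>
  define r where "r = 1 / (norm b + 1)"
  have r: "r > 0" by (simp add: r_def add_nonneg_pos)
  have small: "norm (r *\<^sub>R x) \<le> 1" if "norm x \<le> norm b" for x :: 'a
    using that add_nonneg_pos[OF norm_ge_zero[of b] zero_less_one] by (simp add: r_def divide_le_eq)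
  define c where "c = (r\<^sup>2 / 2) *\<^sub>R a"
  have c_star: "c\<^sup>\<star> = c" by (simp add: c_def a star_scaleR star_add star_mult hk)
  have "norm (1 *\<^sub>R z - c * z) \<le> norm z" for z
  proof -
    \<comment> \<open>\<open>1 - c\<close> is the mean of \<open>1 - (r h)\<^sup>2\<close> and
      \<open>1 - (r k)\<^sup>2\<close>, both of which act as contractions.\<close>
    let ?x = "z - r *\<^sub>R h * r *\<^sub>R h * z" and ?y = "z - r *\<^sub>R k * r *\<^sub>R k * z"
    have "norm ?x \<le> norm z"
      by (rule norm_diff_square_mult_le) (simp_all only: star_scaleR hk(1) small[OF hk(4)])
    moreover have "norm ?y \<le> norm z"
      by (rule norm_diff_square_mult_le) (simp_all only: star_scaleR hk(2) small[OF hk(5)])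
    moreover have "2 *\<^sub>R (z - c * z) = ?x + ?y"
      by (simp add: c_def a power2_eq_square algebra_simps scaleR_2)
    ultimately have "norm (2 *\<^sub>R (z - c * z)) \<le> norm z + norm z"
      by (metis norm_triangle_le add_mono)
    then show ?thesis by simp
  qed
  then obtain v where v: "v\<^sup>\<star> = v" "2 *\<^sub>R v = c + (2 * 1) *\<^sub>R v - v * v"
      "\<And>z. norm (1 *\<^sub>R z - v * z) \<le> norm z"
    using one_minus_root[of c 1] c_star by metis
  \<comment> \<open>A second root makes \<open>v = u * u\<close> a square of a selfadjoint element,
    hence positive.\<close>
  obtain u where u: "u\<^sup>\<star> = u" "2 *\<^sub>R u = v + (2 * 1) *\<^sub>R u - u * u"
    using one_minus_root[of v 1] v by metis
  have vv: "v * v = c" and uu: "u * u = v" using v(2) u(2) by (simp_all add: algebra_simps)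
  \<comment> \<open>This undoes the scaling: \<open>s\<^sup>2 r\<^sup>2 / 2 = 1\<close>.\<close>
  define s where "s = sqrt 2 / r"
  have s: "s > 0" "s * s = 2 / r\<^sup>2" using r by (simp_all add: s_def power2_eq_square)
  show ?thesis
  proof
    have "s *\<^sub>R v = (sqrt s *\<^sub>R u) * (sqrt s *\<^sub>R u)" using s by (simp add: uu)
    then show "positive (s *\<^sub>R v)" using positive_square[of "sqrt s *\<^sub>R u"] by (simp add: star_scaleR u)
    have "s *\<^sub>R v * s *\<^sub>R v = (s * s * (r\<^sup>2 / 2)) *\<^sub>R a" by (simp add: vv c_def)
    also have "\<dots> = a" using r by (simp add: s(2))
    finally show "s *\<^sub>R v * s *\<^sub>R v = a" .
  qed
qed

lemma star_positive: "positive a \<Longrightarrow> (a::'a::cstar_algebra)\<^sup>\<star> = a"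
  by (auto simp: positive_def star_mult star_star)

lemma positive_selfadjoint_root:
  fixes a :: "'a::abelian_cstar_algebra"
  assumes "positive a"
  obtains p where "p\<^sup>\<star> = p" "a = p * p"
  using positive_sqrt_exists[OF assms] star_positive by metis

text \<open>With selfadjoint roots \<open>p\<close> and \<open>q\<close>, both
  \<open>p + \<i> q\<close> and \<open>p - \<i> q\<close> have \<open>a + b\<close> as their square
  in the sense of the C*-identity, and \<open>p\<close> is their mean.\<close>

lemma positive_add:
  fixes a b :: "'a::abelian_cstar_algebra"
  assumes "positive a" "positive b"
  shows "positive (a + b)" "norm a \<le> norm (a + b)"
proof -
  obtain p where p: "p\<^sup>\<star> = p" "a = p * p" using assms(1) by (rule positive_selfadjoint_root)
  obtain q where q: "q\<^sup>\<star> = q" "b = q * q" using assms(2) by (rule positive_selfadjoint_root)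
  let ?x = "p + \<i> *\<^sub>C q" and ?y = "p + \<i> *\<^sub>C (- q)"
  have x: "?x\<^sup>\<star> * ?x = a + b" and y: "?y\<^sup>\<star> * ?y = a + b"
    using star_mult_complex_combination[of p q] star_mult_complex_combination[of p "- q"]
    by (simp_all add: p q mult.commute)
  show "positive (a + b)" unfolding positive_def by (rule exI[of _ ?x]) (simp only: x)
  have "norm ?x = norm ?y" by (rule norm_eq_if_star_mult_eq) (simp only: x y)
  have "2 *\<^sub>R p = ?x + ?y" by (simp add: scaleR_2)
  then have "norm (2 *\<^sub>R p) \<le> norm ?x + norm ?y" by (simp only: norm_triangle_ineq)
  also note \<open>norm ?x = norm ?y\<close>[symmetric]
  finally have "norm (2 *\<^sub>R p) \<le> norm ?x + norm ?x" .
  then have "norm p \<le> norm ?x" by simp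
  then have "(norm p)\<^sup>2 \<le> (norm ?x)\<^sup>2" by simp
  then show "norm a \<le> norm (a + b)"
    using cstar_identity[of p] cstar_identity[of ?x] x by (simp add: p)
qed

lemma positive_scaleR:
  fixes a :: "'a::cstar_algebra"
  assumes "positive a" "0 \<le> r"
  shows "positive (r *\<^sub>R a)"
proof -
  obtain b where "a = b\<^sup>\<star> * b" using assms(1) by (auto simp: positive_def)
  then have "r *\<^sub>R a = (sqrt r *\<^sub>R b)\<^sup>\<star> * (sqrt r *\<^sub>R b)" using assms(2) by (simp add: star_scaleR)
  then show ?thesis by (metis positive_def)
qed

text \<open>For \<open>d = b - c\<close> the positive elements \<open>b d\<^sup>2\<close> and
  \<open>c d\<^sup>2\<close> add up to \<open>(b\<^sup>2 - c\<^sup>2) d = 0\<close>, so both vanish.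
  Then \<open>b d = c d = 0\<close>, whence \<open>d\<^sup>2 = 0\<close>.\<close>

lemma positive_sqrt_unique:
  fixes b c :: "'a::abelian_cstar_algebra"
  assumes "positive b" "positive c" "b * b = c * c"
  shows "b = c"
proof -
  define d where "d = b - c"
  have d: "d\<^sup>\<star> = d" using assms by (simp add: d_def star_diff star_positive)
  obtain p where p: "p\<^sup>\<star> = p" "b = p * p" using assms(1) by (rule positive_selfadjoint_root)
  obtain q where q: "q\<^sup>\<star> = q" "c = q * q" using assms(2) by (rule positive_selfadjoint_root)
  have "d * (b + c) = 0" using assms(3) by (simp add: d_def algebra_simps)
  then have "d * d * (b + c) = 0" by (metis mult.assoc mult_zero_right)
  then have sum: "(p * d) * (p * d) + (q * d) * (q * d) = 0" by (simp add: p q algebra_simps)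
  have "positive ((p * d) * (p * d))" "positive ((q * d) * (q * d))"
    by (auto intro!: positive_square simp: star_mult p q d mult.commute)
  then have "norm ((p * d) * (p * d)) \<le> 0" "norm ((q * d) * (q * d)) \<le> 0"
    using positive_add(2) sum by (metis norm_zero, metis norm_zero add.commute)
  then have "(p * d)\<^sup>\<star> * (p * d) = 0" "(q * d)\<^sup>\<star> * (q * d) = 0"
    by (simp_all add: star_mult p q d mult.commute)
  then have "p * d = 0" "q * d = 0"
    using cstar_identity[of "p * d"] cstar_identity[of "q * d"] by simp_all
  then have "b * d = 0" "c * d = 0" by (simp_all add: p q mult.assoc)
  then have "d * d = 0" by (simp add: d_def algebra_simps)
  then have "d = 0" using cstar_identity[of d] d by simp
  then show ?thesis by (simp add: d_def)
qed

lemma positive_sqrt: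
  fixes a :: "'a::abelian_cstar_algebra"
  assumes "positive a"
  shows "positive (positive_sqrt a)" "positive_sqrt a * positive_sqrt a = a"
proof -
  have "\<exists>!b. positive b \<and> b * b = a"
    using positive_sqrt_exists[OF assms] positive_sqrt_unique by metis
  from theI'[OF this] show "positive (positive_sqrt a)" "positive_sqrt a * positive_sqrt a = a"
    by (simp_all add: positive_sqrt_def)
qed

text \<open>With \<open>(1 - w)\<^sup>2 = 1 - b / norm b\<close>, the element is
  \<open>norm b\<close> times \<open>((1 - w) a)\<^sup>\<star> ((1 - w) a)\<close>. It serves the
  Cauchy-Schwarz inequality of the module.\<close>

lemma positive_norm_bound:
  fixes a b :: "'a::abelian_cstar_algebra"
  assumes "positive b"
  shows "positive (norm b *\<^sub>R (a\<^sup>\<star> * a) - a\<^sup>\<star> * (b * a))"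
proof (cases "b = 0")
  case True
  then show ?thesis using positive_square[of "0::'a"] by simp
next
  case False
  let ?c = "b /\<^sub>R norm b"
  have "?c\<^sup>\<star> = ?c" "norm ?c \<le> 1" using assms False by (simp_all add: star_scaleR star_positive)
  then obtain w where w: "w\<^sup>\<star> = w" "w + w = ?c + w * w" by (rule one_minus_eq_square)
  have "(a - w * a)\<^sup>\<star> * (a - w * a) = a\<^sup>\<star> * a - a\<^sup>\<star> * a * (w + w - w * w)"
    by (simp add: star_diff star_mult w(1) algebra_simps)
  also have "w + w - w * w = ?c" by (simp add: w(2))
  finally have "positive (a\<^sup>\<star> * a - a\<^sup>\<star> * a * ?c)" by (metis positive_def)
  then have "positive (norm b *\<^sub>R (a\<^sup>\<star> * a - a\<^sup>\<star> * a * ?c))" by (rule positive_scaleR) simp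
  then show ?thesis using False by (simp add: scaleR_diff_right mult.assoc mult.commute mult.left_commute)
qed

section \<open>Semi-inner products\<close>

locale semi_inner_product =
  fixes B :: "'e::complex_vector \<Rightarrow> 'e \<Rightarrow> complex"
  assumes add_right: "B x (y + z) = B x y + B x z"
    and scaleC_right: "B x (c *\<^sub>C y) = c * B x y"
    and cnj_commute: "cnj (B x y) = B y x"
    and Re_nonneg: "0 \<le> Re (B x x)"
begin

lemma add_left: "B (x + y) z = B x z + B y z"
  by (metis add_right cnj_commute complex_cnj_add)

lemma scaleC_left: "B (c *\<^sub>C x) y = cnj c * B x y"
  by (metis scaleC_right cnj_commute complex_cnj_mult)

lemma diff_right: "B x (y - z) = B x y - B x z"
  using add_right[of x "y - z" z] by simp

lemma diff_left: "B (x - y) z = B x z - B y z"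
  using add_left[of "x - y" y z] by simp

text \<open>Positivity at \<open>x - t (cnj (B x y)) y\<close> for real \<open>t\<close> gives a
  quadratic in \<open>t\<close>. If \<open>Re (B y y) > 0\<close>, its minimum at
  \<open>t = 1 / Re (B y y)\<close> gives the claim; otherwise it is affine and must be
  constant.\<close>

lemma Cauchy_Schwarz: "(cmod (B x y))\<^sup>2 \<le> Re (B x x) * Re (B y y)"
proof -
  define b where "b = (cmod (B x y))\<^sup>2"
  have quad: "0 \<le> Re (B x x) - 2 * t * b + t\<^sup>2 * b * Re (B y y)" for t :: real
  proof -
    define c where "c = complex_of_real t * cnj (B x y)"
    have bb: "B x y * cnj (B x y) = complex_of_real b"
      by (simp add: b_def complex_norm_square[symmetric])
    have "B (x - c *\<^sub>C y) (x - c *\<^sub>C y) = B x x - c * B x y - cnj c * B y x + cnj c * c * B y y"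
      by (simp add: diff_left diff_right scaleC_left scaleC_right algebra_simps)
    also have "c * B x y = complex_of_real (t * b)" using bb by (simp add: c_def mult.commute)
    also have "cnj c * B y x = complex_of_real (t * b)"
      using bb by (simp add: c_def flip: cnj_commute[of x y])
    also have "cnj c * c = complex_of_real (t\<^sup>2 * b)"
      using bb by (simp add: c_def power2_eq_square algebra_simps)
    finally have "Re (B (x - c *\<^sub>C y) (x - c *\<^sub>C y))
        = Re (B x x) - t * b - t * b + t\<^sup>2 * b * Re (B y y)"
      by (simp del: of_real_mult of_real_power)
    then show ?thesis using Re_nonneg[of "x - c *\<^sub>C y"] by linarith
  qed
  show ?thesis
  proof (cases "Re (B y y) = 0")
    case True
    have "b = 0"
    proof (rule ccontr)
      assume "b \<noteq> 0"
      \<comment> \<open>At this value of \<open>t\<close> the affine function equals -1.\<close>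
      then have "2 * ((Re (B x x) + 1) / (2 * b)) * b = Re (B x x) + 1" by simp
      then show False using quad[of "(Re (B x x) + 1) / (2 * b)"] True by simp
    qed
    then show ?thesis using True by (simp add: b_def)
  next
    case False
    then have "Re (B y y) > 0" using Re_nonneg[of y] by simp
    moreover from this have "0 \<le> Re (B x x) - b / Re (B y y)"
      using quad[of "1 / Re (B y y)"] by (simp add: power2_eq_square field_simps)
    ultimately show ?thesis by (simp add: b_def field_simps)
  qed
qed

section \<open>The seminorm and numerical radius estimates\<close>

definition seminorm :: "'e \<Rightarrow> real" where
  "seminorm x = sqrt (Re (B x x))"

lemma seminorm_nonneg [simp]: "0 \<le> seminorm x"
  by (simp add: seminorm_def Re_nonneg)

lemma seminorm_square: "(seminorm x)\<^sup>2 = Re (B x x)"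
  by (simp add: seminorm_def Re_nonneg)

lemma cmod_le_seminorm: "cmod (B x y) \<le> seminorm x * seminorm y"
  using Cauchy_Schwarz[of x y]
  by - (rule power2_le_imp_le, simp_all add: power_mult_distrib seminorm_square)

lemma seminorm_triangle: "seminorm (x + y) \<le> seminorm x + seminorm y"
proof (rule power2_le_imp_le)
  have "Re (B x y) \<le> seminorm x * seminorm y" "Re (B y x) \<le> seminorm x * seminorm y"
    using complex_Re_le_cmod cmod_le_seminorm order_trans mult.commute by metis+
  then show "(seminorm (x + y))\<^sup>2 \<le> (seminorm x + seminorm y)\<^sup>2"
    by (simp add: power2_sum seminorm_square add_left add_right)
qed simp

lemma seminorm_scaleC: "seminorm (c *\<^sub>C x) = cmod c * seminorm x"
proof -
  have "B (c *\<^sub>C x) (c *\<^sub>C x) = complex_of_real ((cmod c)\<^sup>2) * B x x"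
    by (simp only: complex_norm_square scaleC_left scaleC_right mult_ac)
  then have "Re (B (c *\<^sub>C x) (c *\<^sub>C x)) = (cmod c)\<^sup>2 * Re (B x x)"
    by (simp del: of_real_power)
  then show ?thesis by (simp only: seminorm_def real_sqrt_mult real_sqrt_abs abs_norm_cancel)
qed

text \<open>Polarization expresses \<open>Re (B (H x) u)\<close> by the quadratic form of
  \<open>H\<close> at \<open>x + u\<close> and \<open>x - u\<close>, and the parallelogram law
  bounds the sum of their squared seminorms. The choice \<open>u = H x / w\<close> balances the two
  terms; for \<open>w = 0\<close>, \<open>u = H x\<close> suffices.\<close>

lemma selfadjoint_seminorm_le:
  assumes H: "\<And>x y. B (H x) y = B x (H y)"
    and w: "\<And>x. cmod (B (H x) x) \<le> w * Re (B x x)" "0 \<le> w"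
  shows "seminorm (H x) \<le> w * seminorm x"
proof -
  let ?N = "Re (B (H x) (H x))" and ?X = "Re (B x x)"
  \<comment> \<open>Selfadjointness makes \<open>H\<close> additive as seen by \<open>B\<close>; as
    a map, \<open>H\<close> may fail to be additive.\<close>
  have G_add: "B (H (a + b)) z = B (H a) z + B (H b) z" for a b z
    by (simp add: H add_left)
  have G_diff: "B (H (a - b)) z = B (H a) z - B (H b) z" for a b z
    by (simp add: H diff_left)
  have key: "4 * c * ?N \<le> w * (2 * ?X + 2 * c\<^sup>2 * ?N)" for c :: real
  proof -
    define u where "u = complex_of_real c *\<^sub>C H x"
    have Gu: "B (H u) x = cnj (B (H x) u)" by (simp add: H cnj_commute)
    have "B (H (x + u)) (x + u) - B (H (x - u)) (x - u) = 2 * (B (H x) u + B (H u) x)"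
      by (simp add: G_add G_diff add_right diff_right)
    then have "4 * Re (B (H x) u) = Re (B (H (x + u)) (x + u)) - Re (B (H (x - u)) (x - u))"
      by (simp add: Gu complex_eq_iff)
    also have "\<dots> \<le> cmod (B (H (x + u)) (x + u)) + cmod (B (H (x - u)) (x - u))"
      using abs_Re_le_cmod[of "B (H (x + u)) (x + u)"] abs_Re_le_cmod[of "B (H (x - u)) (x - u)"]
      by linarith
    also have "\<dots> \<le> w * (Re (B (x + u) (x + u)) + Re (B (x - u) (x - u)))"
      using w(1)[of "x + u"] w(1)[of "x - u"] by (simp add: distrib_left)
    also have "Re (B (x + u) (x + u)) + Re (B (x - u) (x - u)) = 2 * ?X + 2 * Re (B u u)"
      by (simp add: add_left add_right diff_left diff_right)
    finally show ?thesis
      by (simp add: u_def scaleC_left scaleC_right power2_eq_square mult_ac)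
  qed
  have "?N \<le> w\<^sup>2 * ?X"
  proof (cases "w = 0")
    case True
    then show ?thesis using key[of 1] by simp
  next
    case False
    then show ?thesis using key[of "1 / w"] w(2) by (simp add: power2_eq_square field_simps)
  qed
  then have "(seminorm (H x))\<^sup>2 \<le> (w * seminorm x)\<^sup>2"
    by (simp add: seminorm_square power_mult_distrib)
  then show ?thesis by (rule power2_le_imp_le) (simp add: w(2))
qed

lemma cmod_square_le_seminorm:
  assumes adj: "\<And>x y. B (T x) y = B x (S y)" and x: "Re (B x x) = 1"
  shows "(cmod (B (T x) x))\<^sup>2 \<le> 1/2 * seminorm (S (T x) + T (S x))"
proof -
  let ?P = "S (T x) + T (S x)"
  have adj': "B (S u) v = B u (T v)" for u v by (metis adj cnj_commute)
  have "(cmod (B (T x) x))\<^sup>2 \<le> Re (B (T x) (T x))"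
    using Cauchy_Schwarz[of "T x" x] x by simp
  moreover have "(cmod (B (T x) x))\<^sup>2 \<le> Re (B (S x) (S x))"
    using Cauchy_Schwarz[of x "S x"] x by (simp add: adj)
  moreover have "Re (B (T x) (T x)) + Re (B (S x) (S x)) = Re (B ?P x)"
    by (simp add: add_left adj' adj)
  moreover have "Re (B ?P x) \<le> seminorm ?P"
    using complex_Re_le_cmod[of "B ?P x"] cmod_le_seminorm[of ?P x] x by (simp add: seminorm_def)
  ultimately show ?thesis by simp
qed

text \<open>For \<open>T = H + \<i> K\<close> with \<open>H\<close>, \<open>K\<close> selfadjoint, \<open>S T + T S = 2 (H\<^sup>2 + K\<^sup>2)\<close>.\<close>

lemma seminorm_le_square:
  assumes adj: "\<And>x y. B (T x) y = B x (S y)"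
    and T_add: "\<And>x y. T (x + y) = T x + T y" and T_scaleC: "\<And>c x. T (c *\<^sub>C x) = c *\<^sub>C T x"
    and S_add: "\<And>x y. S (x + y) = S x + S y" and S_scaleC: "\<And>c x. S (c *\<^sub>C x) = c *\<^sub>C S x"
    and w: "\<And>x. cmod (B (T x) x) \<le> w * Re (B x x)" "0 \<le> w"
  shows "seminorm (S (T x) + T (S x)) \<le> 4 * w\<^sup>2 * seminorm x"
proof -
  have adj': "B (S u) v = B u (T v)" for u v by (metis adj cnj_commute)
  have ST: "cmod (B (S x) x) = cmod (B (T x) x)" for x
    by (metis adj cnj_commute complex_mod_cnj)
  \<comment> \<open>\<open>L (1/2)\<close> and \<open>L (- \<i>/2)\<close> are the real and
    imaginary parts of \<open>T\<close>; the parameter treats both at once.\<close>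
  define L where "L c x = c *\<^sub>C T x + cnj c *\<^sub>C S x" for c x
  have L_adj: "B (L c x) y = B x (L c y)" for c x y
    by (simp add: L_def add_left add_right scaleC_left scaleC_right adj adj')
  have L_le: "cmod (B (L c x) x) \<le> w * Re (B x x)" if "cmod c = 1/2" for c x
  proof -
    have "cmod (B (L c x) x) \<le> cmod (cnj c * B (T x) x) + cmod (c * B (S x) x)"
      by (simp add: L_def add_left scaleC_left norm_triangle_ineq)
    also have "\<dots> = cmod (B (T x) x)" by (simp add: norm_mult that ST)
    finally show ?thesis using w(1)[of x] by simp
  qed
  have L_seminorm: "seminorm (L c (L c x)) \<le> w\<^sup>2 * seminorm x" if "cmod c = 1/2" for c x
    using selfadjoint_seminorm_le[OF L_adj L_le[OF that] w(2), of "L c x"]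
      mult_left_mono[OF selfadjoint_seminorm_le[OF L_adj L_le[OF that] w(2), of x] w(2)]
    by (simp add: power2_eq_square mult.assoc)
  let ?H = "L (1/2)" and ?K = "L (- \<i>/2)"
  have "S (T x) + T (S x) = 2 *\<^sub>C (?H (?H x) + ?K (?K x))"
  proof -
    have LL: "L c (L c x) = (c * c) *\<^sub>C T (T x) + (c * cnj c) *\<^sub>C (S (T x) + T (S x))
        + (cnj c * cnj c) *\<^sub>C S (S x)" for c
      by (simp add: L_def T_add T_scaleC S_add S_scaleC scaleC_add_right scaleC_scaleC mult.commute
          add_ac)
    \<comment> \<open>The squares of \<open>1/2\<close> and \<open>- \<i>/2\<close> are opposite, so
      the terms with \<open>T (T x)\<close> and \<open>S (S x)\<close> cancel.\<close>
    have "?H (?H x) + ?K (?K x)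
        = ((1/4) *\<^sub>C T (T x) + (-1/4) *\<^sub>C T (T x)) + ((1/4) *\<^sub>C S (S x) + (-1/4) *\<^sub>C S (S x))
          + ((1/4) *\<^sub>C (S (T x) + T (S x)) + (1/4) *\<^sub>C (S (T x) + T (S x)))"
      by (simp add: LL add_ac)
    then show ?thesis
      by (simp only: scaleC_add_left[symmetric] scaleC_scaleC) (simp add: scaleC_scaleC scaleC_one)
  qed
  then have "seminorm (S (T x) + T (S x)) \<le> 2 * (seminorm (?H (?H x)) + seminorm (?K (?K x)))"
    using seminorm_triangle[of "?H (?H x)" "?K (?K x)"] by (simp add: seminorm_scaleC)
  also have "\<dots> \<le> 4 * w\<^sup>2 * seminorm x"
    using L_seminorm[of "1/2" x] L_seminorm[of "- \<i>/2" x] by (simp add: norm_divide)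
  finally show ?thesis .
qed

end

section \<open>Characters and Hilbert modules\<close>

lemma characters_scaleR:
  "\<phi> \<in> characters \<Longrightarrow> \<phi> (r *\<^sub>R a) = complex_of_real r * \<phi> a"
  by (simp add: characters_def scaleR_scaleC)

lemma characters_positive:
  assumes "\<phi> \<in> characters" "positive a"
  obtains r where "0 \<le> r" "\<phi> a = complex_of_real r"
proof -
  obtain b where "a = b\<^sup>\<star> * b" using assms(2) by (auto simp: positive_def)
  then have "\<phi> a = complex_of_real ((cmod (\<phi> b))\<^sup>2)"
    using assms(1) by (simp only: complex_norm_square) (simp add: characters_def mult.commute)
  then show thesis by (rule that[rotated]) simp
qed

text \<open>With \<open>(1 - w)\<^sup>2 = 1 - a / norm a\<close> and \<open>w\<close> selfadjoint,
  \<open>\<phi> w\<close> is real and \<open>1 - \<phi> a / norm a = (1 - \<phi> w)\<^sup>2\<close>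
  is nonnegative.\<close>

lemma characters_positive_le_norm:
  fixes a :: "'a::abelian_cstar_algebra"
  assumes \<phi>: "\<phi> \<in> characters" and a: "positive a"
  shows "Re (\<phi> a) \<le> norm a"
proof (cases "a = 0")
  case True
  then show ?thesis using characters_scaleR[OF \<phi>, of 0 a] by simp
next
  case False
  let ?c = "a /\<^sub>R norm a"
  have "?c\<^sup>\<star> = ?c" "norm ?c \<le> 1" using a False by (simp_all add: star_scaleR star_positive)
  then obtain w where w: "w\<^sup>\<star> = w" "w + w = ?c + w * w" by (rule one_minus_eq_square)
  have "\<phi> (w\<^sup>\<star>) = cnj (\<phi> w)" using \<phi> by (simp add: characters_def)
  then have real: "Im (\<phi> w) = 0" by (simp add: w(1) complex_eq_iff)
  have "\<phi> (w + w) = \<phi> w + \<phi> w" "\<phi> (?c + w * w) = \<phi> ?c + \<phi> w * \<phi> w"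
    using \<phi> by (auto simp: characters_def)
  then have "\<phi> ?c = \<phi> w + \<phi> w - \<phi> w * \<phi> w" using w(2) by (simp add: eq_diff_eq)
  then have "Re (\<phi> ?c) = Re (\<phi> w + \<phi> w - \<phi> w * \<phi> w)" by (rule arg_cong)
  then have "Re (\<phi> ?c) = 1 - (1 - Re (\<phi> w))\<^sup>2"
    by (simp add: real power2_eq_square algebra_simps)
  then have "Re (\<phi> ?c) \<le> 1" by simp
  then show ?thesis using False by (simp add: characters_scaleR[OF \<phi>] field_simps)
qed

locale abelian_hilbert_module = hilbert_module act ip
  for act :: "'e::complex_vector \<Rightarrow> 'a::abelian_cstar_algebra \<Rightarrow> 'e" and ip :: "'e \<Rightarrow> 'e \<Rightarrow> 'a"
begin

section \<open>Calculus of the algebra-valued inner product\<close>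

lemma ip_add_right: "ip x (y + z) = ip x y + ip x z"
  using ip_linear[of x 1 y 1 z] by (simp add: scaleC_one)

lemma ip_scaleC_right: "ip x (c *\<^sub>C y) = c *\<^sub>C ip x y"
  using ip_linear[of x c y 0 y] by simp

lemma ip_add_left: "ip (x + y) z = ip x z + ip y z"
  by (metis ip_add_right ip_star star_add)

lemma ip_scaleC_left: "ip (c *\<^sub>C x) y = cnj c *\<^sub>C ip x y"
  by (metis ip_scaleC_right ip_star star_scaleC)

lemma ip_act_left: "ip (act x a) y = a\<^sup>\<star> * ip x y"
  by (metis ip_act ip_star star_mult)

lemma ip_diff_right: "ip x (y - z) = ip x y - ip x z"
  using ip_add_right[of x "y - z" z] by simp

lemma ip_diff_left: "ip (x - y) z = ip x z - ip y z"
  using ip_add_left[of "x - y" y z] by simp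

lemma ip_zero [simp]: "ip x 0 = 0" "ip 0 x = 0"
  using ip_diff_right[of x x x] ip_diff_left[of x x x] by simp_all

lemma ip_ext:
  assumes "\<And>u. ip u v = ip u w"
  shows "v = w"
proof -
  have "ip (v - w) (v - w) = 0" by (simp only: ip_diff_right assms) simp
  then show ?thesis using ip_definite by fastforce
qed

section \<open>The module norm and boundedness of adjointable maps\<close>

abbreviation mnorm :: "'e \<Rightarrow> real" where
  "mnorm \<equiv> module_norm ip"

lemma mnorm_nonneg [simp]: "0 \<le> mnorm x"
  by (simp add: module_norm_def)

lemma mnorm_square: "(mnorm x)\<^sup>2 = norm (ip x x)"
  by (simp add: module_norm_def)

lemma mnorm_0 [simp]: "mnorm 0 = 0"
  by (simp add: module_norm_def)

lemma mnorm_eq_0: "mnorm x = 0 \<longleftrightarrow> x = 0"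
  using ip_definite by (auto simp: module_norm_def)

lemma mnorm_scaleC: "mnorm (c *\<^sub>C x) = cmod c * mnorm x"
  by (simp add: module_norm_def ip_scaleC_left ip_scaleC_right norm_scaleC real_sqrt_mult)

lemma mnorm_minus_commute: "mnorm (x - y) = mnorm (y - x)"
  by (simp add: module_norm_def ip_diff_left ip_diff_right algebra_simps)

text \<open>Subtracting from \<open>x\<close> its approximate component along \<open>y\<close>, with
  \<open>norm (ip y y)\<close> in place of an inverse of \<open>ip y y\<close>, leaves
  \<open>w\<close>. Then \<open>ip x x\<close> exceeds \<open>a\<^sup>\<star> a / l\<close> by a
  positive element, and the norm is monotone.\<close>

lemma norm_ip_le: "norm (ip x y) \<le> mnorm x * mnorm y"
proof (cases "y = 0")
  case False
  define l where "l = norm (ip y y)"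
  have l: "l > 0" using False ip_definite by (auto simp: l_def)
  define a where "a = ip y x"
  have ax: "ip x y = a\<^sup>\<star>" by (simp add: a_def ip_star)
  define w where "w = x - act y ((1/l) *\<^sub>R a)"
  define p where "p = l *\<^sub>R (a\<^sup>\<star> * a) - a\<^sup>\<star> * (ip y y * a)"
  have p: "positive p" unfolding p_def l_def by (rule positive_norm_bound) (rule ip_positive)
  have "ip w w = ip x x - (1/l) *\<^sub>R (a\<^sup>\<star> * a) - (1/l) *\<^sub>R (a\<^sup>\<star> * a)
      + (1/l * (1/l)) *\<^sub>R (a\<^sup>\<star> * (ip y y * a))"
    by (simp add: w_def ip_diff_left ip_diff_right ip_act ip_act_left ax star_scaleR mult.assoc
        left_diff_distrib scaleR_diff_right flip: a_def)
  also have "(1/l * (1/l)) *\<^sub>R (a\<^sup>\<star> * (ip y y * a)) = (1/l) *\<^sub>R (a\<^sup>\<star> * a) - (1/l * (1/l)) *\<^sub>R p"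
    using l by (simp add: p_def scaleR_diff_right)
  finally have "ip x x = (1/l) *\<^sub>R (a\<^sup>\<star> * a) + (ip w w + (1/l * (1/l)) *\<^sub>R p)"
    by simp
  moreover have "positive ((1/l) *\<^sub>R (a\<^sup>\<star> * a))"
    using l by (intro positive_scaleR) (auto simp: positive_def)
  moreover have "positive (ip w w + (1/l * (1/l)) *\<^sub>R p)"
    using l p by (intro positive_add positive_scaleR ip_positive) auto
  ultimately have "norm ((1/l) *\<^sub>R (a\<^sup>\<star> * a)) \<le> norm (ip x x)"
    using positive_add(2) by metis
  then have "(norm a)\<^sup>2 \<le> norm (ip x x) * norm (ip y y)"
    using l cstar_identity[of a] by (simp add: field_simps flip: l_def)
  then have "(norm (ip x y))\<^sup>2 \<le> (mnorm x * mnorm y)\<^sup>2"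
    by (simp add: ax power_mult_distrib mnorm_square)
  then show ?thesis by (rule power2_le_imp_le) simp
qed simp

lemma mnorm_triangle: "mnorm (x + y) \<le> mnorm x + mnorm y"
proof (rule power2_le_imp_le)
  have "norm (ip (x + y) (x + y)) \<le> norm (ip x x) + norm (ip x y) + (norm (ip y x) + norm (ip y y))"
    by (simp add: ip_add_left ip_add_right)
      (smt (verit) norm_triangle_ineq)
  then show "(mnorm (x + y))\<^sup>2 \<le> (mnorm x + mnorm y)\<^sup>2"
    using norm_ip_le[of x y] norm_ip_le[of y x] mult.commute[of "mnorm y" "mnorm x"]
    unfolding power2_sum mnorm_square by linarith
qed simp

text \<open>Hellinger--Toeplitz by a gliding hump: were \<open>T\<close> unbounded on the sequence \<open>y\<close>, the functionals
  \<open>A n = ip (T (y n))\<close>, which equal \<open>ip (y n) \<circ> S\<close>, would blow up relative to \<open>mnorm (y n)\<close> at the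
  limit of steps of length \<open>3\<^sup>-\<^sup>n\<close> in the directions \<open>\<plusminus> T (y n)\<close>.\<close>

lemma adjoint_bounded:
  assumes adj: "\<And>x y. ip (T x) y = ip x (S y)"
  obtains M where "0 < M" "\<And>x. mnorm (T x) \<le> M * mnorm x"
proof -
  have "\<exists>M>0. \<forall>x. mnorm (T x) \<le> M * mnorm x"
  proof (rule ccontr)
    assume "\<not> ?thesis"
    \<comment> \<open>The base 4 beats the step ratio 3 below and leaves the growth
      \<open>(4/3) ^ n\<close>.\<close>
    then have "\<exists>x. mnorm (T x) > 4 ^ n * mnorm x" for n :: nat
      by (meson not_le zero_less_numeral zero_less_power)
    then obtain y where y: "\<And>n. mnorm (T (y n)) > 4 ^ n * mnorm (y n)" by metis
    define K where "K n = mnorm (T (y n))" for n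
    have K_pos: "K n > 0" for n
    proof -
      have "0 \<le> 4 ^ n * mnorm (y n)" by simp
      then show ?thesis using y[of n] unfolding K_def by linarith
    qed
    define A where "A n z = ip (T (y n)) z" for n z
    define f where "f n = complex_of_real ((1/3) ^ n / K n) *\<^sub>C T (y n)" for n
    have f_norm: "mnorm (f n) = (1/3) ^ n" for n
      unfolding f_def mnorm_scaleC norm_of_real K_def[symmetric] using K_pos[of n] by simp
    have A_f: "norm (A n (f n)) = (1/3) ^ n * K n" for n
      unfolding A_def f_def ip_scaleC_right norm_scaleC norm_of_real mnorm_square[symmetric]
        K_def[symmetric]
      using K_pos[of n] by (simp add: power2_eq_square)
    \<comment> \<open>The values of \<open>A n\<close> at \<open>z n + f n\<close> and
      \<open>z n - f n\<close> differ by \<open>2 A n (f n)\<close>, so one of the two signs makes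
      \<open>A n\<close> at least as large as at \<open>f n\<close>.\<close>
    define z where "z = rec_nat 0 (\<lambda>n z. if norm (A n (z + f n)) \<ge> (1/3) ^ n * K n then z + f n else z - f n)"
    have z_Suc: "z (Suc n) = (if norm (A n (z n + f n)) \<ge> (1/3) ^ n * K n then z n + f n else z n - f n)" for n
      by (simp add: z_def)
    have A_z: "norm (A n (z (Suc n))) \<ge> (1/3) ^ n * K n" for n
    proof (cases "norm (A n (z n + f n)) \<ge> (1/3) ^ n * K n")
      case False
      have "2 *\<^sub>R A n (f n) = A n (z n + f n) - A n (z n - f n)"
        by (simp add: A_def ip_add_right ip_diff_right scaleR_2)
      then have "norm (2 *\<^sub>R A n (f n)) \<le> norm (A n (z n + f n)) + norm (A n (z n - f n))"
        by (simp only: norm_triangle_ineq4)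
      then show ?thesis using False by (simp add: z_Suc A_f)
    qed (simp add: z_Suc)
    have z_step: "mnorm (z (Suc n) - z n) = (1/3) ^ n" for n
      using f_norm[of n] mnorm_minus_commute[of 0 "f n"] by (simp add: z_Suc)
    have z_dist: "mnorm (z (n + k) - z n) \<le> 3/2 * ((1/3) ^ n - (1/3) ^ (n + k))" for n k
    proof (induction k)
      case (Suc k)
      have "mnorm (z (n + Suc k) - z n) \<le> (1/3) ^ (n + k) + mnorm (z (n + k) - z n)"
        using mnorm_triangle[of "z (Suc (n + k)) - z (n + k)" "z (n + k) - z n"]
        by (simp add: z_step)
      moreover have "(1/3::real) ^ (n + Suc k) = 1/3 * (1/3) ^ (n + k)" by simp
      moreover have "d \<le> p + c \<Longrightarrow> q = 1/3 * p \<Longrightarrow> c \<le> 3/2 * (a - p) \<Longrightarrow> d \<le> 3/2 * (a - q)"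
        for a c d p q :: real
        by (simp add: field_simps)
      ultimately show ?case using Suc by blast
    qed simp
    have z_dist': "mnorm (z m - z n) \<le> 3/2 * (1/3) ^ n" if "n \<le> m" for m n
    proof -
      have "0 \<le> (1/3::real) ^ (n + (m - n))" by simp
      then have "3/2 * ((1/3) ^ n - (1/3) ^ (n + (m - n))) \<le> 3/2 * (1/3::real) ^ n"
        by (intro mult_left_mono) auto
      then have "mnorm (z (n + (m - n)) - z n) \<le> 3/2 * (1/3) ^ n"
        using z_dist[of n "m - n"] by (rule order_trans[rotated])
      then show ?thesis using that by simp
    qed
    have "\<exists>l. (\<lambda>n. mnorm (z n - l)) \<longlonglongrightarrow> 0"
    proof (rule complete, intro allI impI)
      fix e :: real
      assume "e > 0"
      then obtain N where N: "(1/3) ^ N < e / 3"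
        using real_arch_pow_inv[of "e / 3" "1/3"] by auto
      have "mnorm (z m - z n) < e" if "N \<le> m" "N \<le> n" for m n
        using mnorm_triangle[of "z m - z N" "z N - z n"] z_dist'[OF that(1)] z_dist'[OF that(2)]
          mnorm_minus_commute[of "z N" "z n"] N by simp
      then show "\<exists>N. \<forall>m\<ge>N. \<forall>n\<ge>N. mnorm (z m - z n) < e" by blast
    qed
    then obtain l where l: "(\<lambda>n. mnorm (z n - l)) \<longlonglongrightarrow> 0" by blast
    have z_l: "mnorm (z n - l) \<le> 3/2 * (1/3) ^ n" for n
    proof -
      have lim: "(\<lambda>m. 3/2 * (1/3) ^ n + mnorm (z m - l)) \<longlonglongrightarrow> 3/2 * (1/3) ^ n + 0"
        by (intro tendsto_intros l)
      have "mnorm (z n - l) \<le> 3/2 * (1/3) ^ n + mnorm (z m - l)" if "n \<le> m" for m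
        using mnorm_triangle[of "z n - z m" "z m - l"] z_dist'[OF that] mnorm_minus_commute[of "z n" "z m"]
        by simp
      then show ?thesis using Lim_bounded2[OF lim, of n] by simp
    qed
    \<comment> \<open>All later steps together have length at most \<open>(1/3) ^ n / 2\<close>, so
      at \<open>l\<close> at least half of the lower bound in \<open>A_z\<close> survives.\<close>
    have growth: "(4/3) ^ n \<le> 2 * mnorm (S l)" for n
    proof -
      have "A n (z (Suc n)) = A n (z (Suc n) - l) + A n l"
        by (simp add: A_def flip: ip_add_right)
      then have "norm (A n (z (Suc n))) \<le> norm (A n (z (Suc n) - l)) + norm (A n l)"
        by (simp only: norm_triangle_ineq)
      moreover have "norm (A n (z (Suc n) - l)) \<le> K n * (3/2 * (1/3) ^ Suc n)"
        using norm_ip_le[of "T (y n)" "z (Suc n) - l"]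
          mult_left_mono[OF z_l[of "Suc n"] less_imp_le[OF K_pos[of n]]]
        unfolding A_def K_def by linarith
      moreover have "K n * (3/2 * (1/3) ^ Suc n) = (1/3) ^ n * K n / 2" by simp
      moreover have "norm (A n l) \<le> mnorm (y n) * mnorm (S l)"
        unfolding A_def adj by (rule norm_ip_le)
      moreover have "a \<le> b + c \<Longrightarrow> b \<le> r \<Longrightarrow> r = q / 2 \<Longrightarrow> c \<le> d \<Longrightarrow> q \<le> a \<Longrightarrow> q \<le> 2 * d"
        for a b c d q r :: real by linarith
      ultimately have 1: "(1/3) ^ n * K n \<le> 2 * (mnorm (y n) * mnorm (S l))"
        using A_z[of n] by blast
      have "y n \<noteq> 0"
      proof
        assume "y n = 0"
        then have "T (y n) = 0" using adj[of 0] ip_definite by simp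
        then show False using K_pos[of n] by (simp add: K_def)
      qed
      then have y_pos: "mnorm (y n) > 0" using mnorm_eq_0[of "y n"] mnorm_nonneg[of "y n"] by linarith
      have "(1/3) ^ n * (4 ^ n * mnorm (y n)) \<le> (1/3) ^ n * K n"
        using y[of n] by (intro mult_left_mono) (auto simp: K_def)
      with 1 have "(1/3) ^ n * (4 ^ n * mnorm (y n)) \<le> 2 * (mnorm (y n) * mnorm (S l))" by (rule order_trans[rotated])
      then have "((1/3) ^ n * 4 ^ n) * mnorm (y n) \<le> (2 * mnorm (S l)) * mnorm (y n)"
        by (simp add: mult_ac)
      then have "(1/3) ^ n * 4 ^ n \<le> 2 * mnorm (S l)" using y_pos by simp
      then show ?thesis by (simp add: power_divide)
    qed
    obtain n where "2 * mnorm (S l) < (4/3) ^ n" using real_arch_pow[of "4/3"] by auto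
    with growth[of n] show False by simp
  qed
  then show thesis using that by blast
qed

section \<open>Semi-inner products induced by characters\<close>

lemma character_semi_inner_product:
  assumes "\<phi> \<in> characters"
  shows "semi_inner_product (\<lambda>x y. \<phi> (ip x y))"
proof
  fix x y z c
  show "\<phi> (ip x (y + z)) = \<phi> (ip x y) + \<phi> (ip x z)" "\<phi> (ip x (c *\<^sub>C y)) = c * \<phi> (ip x y)"
    using assms by (simp_all add: characters_def ip_add_right ip_scaleC_right)
  have "\<phi> ((ip x y)\<^sup>\<star>) = cnj (\<phi> (ip x y))" using assms by (simp add: characters_def)
  then show "cnj (\<phi> (ip x y)) = \<phi> (ip y x)" by (simp add: ip_star)
  obtain r where "0 \<le> r" "\<phi> (ip x x) = complex_of_real r"
    using assms ip_positive[of x] by (rule characters_positive)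
  then show "0 \<le> Re (\<phi> (ip x x))" by simp
qed

text \<open>The value is nonnegative because \<open>module_abs ip x\<close> is positive, and
  multiplicativity of \<open>\<phi>\<close> determines its square.\<close>

lemma character_module_abs:
  assumes \<phi>: "\<phi> \<in> characters"
  shows "\<phi> (module_abs ip x) = complex_of_real (sqrt (Re (\<phi> (ip x x))))"
proof -
  have p: "positive (module_abs ip x)" "module_abs ip x * module_abs ip x = ip x x"
    unfolding module_abs_def by (rule positive_sqrt[OF ip_positive])+
  obtain r where r: "0 \<le> r" "\<phi> (module_abs ip x) = complex_of_real r"
    using characters_positive[OF \<phi> p(1)] by blast
  have "\<phi> (module_abs ip x * module_abs ip x) = \<phi> (module_abs ip x) * \<phi> (module_abs ip x)"
    using \<phi> by (simp add: characters_def)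
  then have "\<phi> (ip x x) = complex_of_real (r * r)" by (simp add: p(2) r(2))
  then show ?thesis using r by simp
qed

text \<open>A character need not respect the module norm from below, so the bound for \<open>T\<close> is passed to the
  seminorm of \<open>\<phi>\<close> through the powers \<open>(S T)\<^bsup>2^n\<^esup>\<close>: by Cauchy--Schwarz \<open>\<phi> (ip (T x) (T x))\<close> to the
  power \<open>2^n\<close> grows at most like \<open>M\<^bsup>2^n\<^esup>\<close>.\<close>

lemma character_adjoint_bounded:
  assumes adj: "\<And>x y. ip (T x) y = ip x (S y)"
  obtains M where "\<And>\<phi> x. \<phi> \<in> characters \<Longrightarrow> Re (\<phi> (ip x x)) = 1 \<Longrightarrow> Re (\<phi> (ip (T x) (T x))) \<le> M"
proof -
  have adj': "ip (S x) y = ip x (T y)" for x y by (metis adj ip_star)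
  define R where "R = (\<lambda>x. S (T x))"
  have R_adj: "ip (R x) y = ip x (R y)" for x y by (simp add: R_def adj adj')
  obtain M where M: "0 < M" "\<And>x. mnorm (R x) \<le> M * mnorm x"
    using adjoint_bounded[OF R_adj] by blast
  \<comment> \<open>\<open>F n\<close> is \<open>R\<close> iterated \<open>2 ^ n\<close> times.
    Doubling suits Cauchy-Schwarz, since selfadjointness turns \<open>ip (F n x) (F n x)\<close>
    into \<open>ip x (F (Suc n) x)\<close>.\<close>
  define F where "F = rec_nat R (\<lambda>_ f x. f (f x))"
  have F_0: "F 0 = R" and F_Suc: "F (Suc n) x = F n (F n x)" for n x by (simp_all add: F_def)
  have F_adj: "ip (F n x) y = ip x (F n y)" for n x y
    by (induction n arbitrary: x y) (simp_all add: F_0 F_Suc R_adj)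
  have F_bound: "mnorm (F n x) \<le> M ^ (2 ^ n) * mnorm x" for n x
  proof (induction n arbitrary: x)
    case 0
    then show ?case by (simp add: F_0 M)
  next
    case (Suc n)
    have "M ^ (2 ^ n) * mnorm (F n x) \<le> M ^ (2 ^ n) * (M ^ (2 ^ n) * mnorm x)"
      using Suc[of x] M(1) by (intro mult_left_mono) auto
    then have "mnorm (F n (F n x)) \<le> M ^ (2 ^ n) * (M ^ (2 ^ n) * mnorm x)"
      using Suc[of "F n x"] by linarith
    then show ?case by (simp add: F_Suc power_add mult_2)
  qed
  have "Re (\<phi> (ip (T x) (T x))) \<le> M" if \<phi>: "\<phi> \<in> characters" and x: "Re (\<phi> (ip x x)) = 1" for \<phi> x
  proof (rule ccontr)
    interpret semi_inner_product "\<lambda>x y. \<phi> (ip x y)" by (rule character_semi_inner_product[OF \<phi>])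
    let ?g = "Re (\<phi> (ip (T x) (T x)))"
    assume "\<not> ?g \<le> M"
    then have g: "M < ?g" by simp
    have sq: "(cmod (\<phi> (ip x (F n x))))\<^sup>2 \<le> Re (\<phi> (ip (F n x) (F n x)))" for n
      using Cauchy_Schwarz[of x "F n x"] x by simp
    have pow: "?g ^ (2 ^ n) \<le> cmod (\<phi> (ip x (F n x)))" for n
    proof (induction n)
      case 0
      show ?case using complex_Re_le_cmod[of "\<phi> (ip (T x) (T x))"] by (simp add: F_0 R_def adj)
    next
      case (Suc n)
      have "(?g ^ (2 ^ n))\<^sup>2 \<le> (cmod (\<phi> (ip x (F n x))))\<^sup>2"
        using Suc M(1) g by (intro power_mono) auto
      also note sq[of n]
      also have "Re (\<phi> (ip (F n x) (F n x))) \<le> cmod (\<phi> (ip x (F (Suc n) x)))"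
        by (simp add: F_adj F_Suc complex_Re_le_cmod)
      finally show ?case by (simp add: mult.commute flip: power_mult)
    qed
    \<comment> \<open>The right side is free of \<open>n\<close>, so a ratio above 1 is impossible;
      \<open>M\<close> itself depends neither on \<open>\<phi>\<close> nor on
      \<open>x\<close>.\<close>
    have bound: "(?g / M) ^ (2 ^ n) \<le> mnorm x" for n
    proof -
      have "(?g ^ (2 ^ n))\<^sup>2 \<le> (cmod (\<phi> (ip x (F n x))))\<^sup>2"
        using pow[of n] M(1) g by (intro power_mono) auto
      also note sq[of n]
      also have "Re (\<phi> (ip (F n x) (F n x))) \<le> (mnorm (F n x))\<^sup>2"
        unfolding mnorm_square by (rule characters_positive_le_norm[OF \<phi> ip_positive])
      finally have "?g ^ (2 ^ n) \<le> mnorm (F n x)" by (rule power2_le_imp_le) simp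
      also note F_bound[of n x]
      finally show ?thesis using M(1) by (simp add: power_divide field_simps)
    qed
    have gM: "1 < ?g / M" using g M(1) by simp
    then obtain n where "mnorm x < (?g / M) ^ n" using real_arch_pow by blast
    also have "(?g / M) ^ n \<le> (?g / M) ^ (2 ^ n)"
      using gM by (intro power_increasing) (auto simp: less_imp_le)
    also note bound[of n]
    finally show False by simp
  qed
  then show thesis by (rule that)
qed

end

section \<open>Linearity and uniqueness of adjoints\<close>

context abelian_hilbert_module
begin

lemma adjoint_commute:
  assumes "\<And>x y. ip (T x) y = ip x (S y)"
  shows "ip (S x) y = ip x (T y)"
  by (metis assms ip_star)

text \<open>\<open>ip u (T v) = ip (S u) v\<close> is linear in \<open>v\<close> for every
  \<open>u\<close>, and such inner products determine a vector.\<close>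

lemma adjoint_linear:
  assumes adj: "\<And>x y. ip (T x) y = ip x (S y)"
  shows "T (x + y) = T x + T y" "T (c *\<^sub>C x) = c *\<^sub>C T x"
  by (rule ip_ext, simp add: ip_add_right ip_scaleC_right flip: adjoint_commute[of T S, OF adj])+

text \<open>Definiteness makes the adjoint unique, which justifies the definite description in
  \<open>adj\<close>.\<close>

lemma adj_eq:
  assumes "T \<in> adjointable ip"
  shows "ip (T x) y = ip x (adj ip T y)"
proof -
  obtain S where S: "\<forall>x y. ip (T x) y = ip x (S y)" using assms by (auto simp: adjointable_def)
  have "S' = S" if "\<forall>x y. ip (T x) y = ip x (S' y)" for S'
    using that S by (intro ext ip_ext) metis
  then have "\<forall>x y. ip (T x) y = ip x (adj ip T y)"
    unfolding adj_def using S by (rule theI[of _ S, rotated])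
  then show ?thesis by blast
qed

lemma module_abs_eq_1:
  assumes "\<phi> \<in> characters"
  shows "\<phi> (module_abs ip x) = 1 \<longleftrightarrow> Re (\<phi> (ip x x)) = 1"
  by (simp add: character_module_abs[OF assms] del: of_real_sqrt)

end

section \<open>The numerical radius inequality\<close>

theorem theorem3p6:
  fixes act :: "'e::complex_vector \<Rightarrow> 'a::abelian_cstar_algebra \<Rightarrow> 'e"
    and ip :: "'e \<Rightarrow> 'e \<Rightarrow> 'a"
    and T :: "'e \<Rightarrow> 'e"
  assumes "hilbert_module act ip"
    and "T \<in> adjointable ip"
  shows "1/4 * triple_norm ip (\<lambda>x. adj ip T (T x) + T (adj ip T x)) \<le> (omega_o ip T)\<^sup>2 \<and>
    (omega_o ip T)\<^sup>2 \<le> 1/2 * triple_norm ip (\<lambda>x. adj ip T (T x) + T (adj ip T x))"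
proof -
  interpret abelian_hilbert_module act ip using assms(1) by (rule abelian_hilbert_module.intro)
  define S where "S = adj ip T"
  define P where "P = (\<lambda>x. S (T x) + T (S x))"
  have adj: "ip (T x) y = ip x (S y)" for x y unfolding S_def by (rule adj_eq[OF assms(2)])
  note adj' = adjoint_commute[of T S, OF adj]
  \<comment> \<open>Both suprema run over the same pairs, so they can be compared pointwise.\<close>
  define X where "X = {(\<phi>, x). \<phi> \<in> characters \<and> \<phi> (module_abs ip x) = 1}"
  define f where "f = (\<lambda>(\<phi>, x). Re (\<phi> (module_abs ip (P x))))"
  define g where "g = (\<lambda>(\<phi>, x). cmod (\<phi> (ip (T x) x)))"
  have X_D: "\<exists>\<phi> x. p = (\<phi>, x) \<and> \<phi> \<in> characters \<and> Re (\<phi> (ip x x)) = 1" if p: "p \<in> X" for p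
  proof -
    obtain \<phi> x where "p = (\<phi>, x)" "\<phi> \<in> characters" "\<phi> (module_abs ip x) = 1"
      using p by (auto simp: X_def)
    then show ?thesis using module_abs_eq_1 by blast
  qed
  have triple: "triple_norm ip P = sup0 (f ` X)"
    unfolding triple_norm_def
    by (rule arg_cong[of _ _ sup0]) (force simp: X_def f_def)
  have omega: "omega_o ip T = sup0 (g ` X)"
    unfolding omega_o_def
    by (rule arg_cong[of _ _ sup0]) (force simp: X_def g_def)
  have "1/4 * sup0 (f ` X) \<le> (sup0 (g ` X))\<^sup>2 \<and> (sup0 (g ` X))\<^sup>2 \<le> 1/2 * sup0 (f ` X)"
  proof (cases "X = {}")
    \<comment> \<open>Without admissible pairs, as for the zero module, both suprema are 0 by the
      convention in \<open>sup0\<close>.\<close>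
    case True
    then show ?thesis by (simp add: sup0_def)
  next
    case False
    define w where "w = Sup (g ` X)"
    have "bdd_above (g ` X)"
    proof -
      obtain M where M: "\<And>\<phi> x. \<phi> \<in> characters \<Longrightarrow> Re (\<phi> (ip x x)) = 1 \<Longrightarrow> Re (\<phi> (ip (T x) (T x))) \<le> M"
        using character_adjoint_bounded[of T S, OF adj] by blast
      have "g p \<le> sqrt M" if "p \<in> X" for p
      proof -
        obtain \<phi> x where p: "p = (\<phi>, x)" "\<phi> \<in> characters" "Re (\<phi> (ip x x)) = 1"
          using X_D[OF \<open>p \<in> X\<close>] by blast
        interpret semi_inner_product "\<lambda>x y. \<phi> (ip x y)" by (rule character_semi_inner_product[OF p(2)])
        have "(cmod (\<phi> (ip (T x) x)))\<^sup>2 \<le> M" using Cauchy_Schwarz[of "T x" x] M[OF p(2,3)] p(3) by simp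
        then show ?thesis by (simp add: g_def p(1) real_le_rsqrt)
      qed
      then show ?thesis by (auto intro!: bdd_aboveI)
    qed
    then have g_le: "g p \<le> w" if "p \<in> X" for p
      unfolding w_def using that by (auto intro: cSup_upper)
    have w_nonneg: "0 \<le> w"
    proof -
      obtain p where "p \<in> X" using False by blast
      then show ?thesis using g_le[of p] by (cases p) (auto simp: g_def intro: order_trans[OF norm_ge_zero])
    qed
    have f_le: "f p \<le> 4 * w\<^sup>2" and g_square: "(g p)\<^sup>2 \<le> 1/2 * f p" if "p \<in> X" for p
    proof -
      obtain \<phi> x where p: "p = (\<phi>, x)" "\<phi> \<in> characters" "Re (\<phi> (ip x x)) = 1"
        using X_D[OF \<open>p \<in> X\<close>] by blast
      interpret semi_inner_product "\<lambda>x y. \<phi> (ip x y)" by (rule character_semi_inner_product[OF p(2)])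
      have f: "f p = seminorm (P x)" by (simp add: f_def p(1) seminorm_def character_module_abs[OF p(2)])
      \<comment> \<open>Vectors with \<open>\<phi> (ip u u) = 0\<close> are settled by
        Cauchy-Schwarz; all others are scaled to satisfy the normalization in
        \<open>X\<close>.\<close>
      have num: "cmod (\<phi> (ip (T u) u)) \<le> w * Re (\<phi> (ip u u))" for u
      proof (cases "Re (\<phi> (ip u u)) = 0")
        case True
        then show ?thesis using Cauchy_Schwarz[of "T u" u] by simp
      next
        case False
        define r where "r = Re (\<phi> (ip u u))"
        have r: "r > 0" using False Re_nonneg[of u] by (simp add: r_def)
        define c where "c = complex_of_real (1 / sqrt r)"
        have c: "c * c = complex_of_real (1 / r)" "cnj c = c"
          using r by (simp_all add: c_def flip: of_real_mult)
        have "\<phi> (ip (c *\<^sub>C u) (c *\<^sub>C u)) = (c * c) * \<phi> (ip u u)"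
          "\<phi> (ip (T (c *\<^sub>C u)) (c *\<^sub>C u)) = (c * c) * \<phi> (ip (T u) u)"
          by (simp_all only: adjoint_linear(2)[of T S, OF adj] scaleC_left scaleC_right c(2) mult.assoc)
        then have "(\<phi>, c *\<^sub>C u) \<in> X" "g (\<phi>, c *\<^sub>C u) = 1 / r * cmod (\<phi> (ip (T u) u))"
          using r p(2) by (simp_all add: X_def module_abs_eq_1 g_def c(1) norm_mult norm_divide flip: r_def)
        then have "1 / r * cmod (\<phi> (ip (T u) u)) \<le> w" using g_le by metis
        then show ?thesis using r by (simp add: field_simps flip: r_def)
      qed
      have "seminorm (P x) \<le> 4 * w\<^sup>2 * seminorm x"
        unfolding P_def
        by (rule seminorm_le_square)
          (simp_all add: adj num[unfolded adj] w_nonneg adjoint_linear[of T S, OF adj] adjoint_linear[of S T, OF adj'])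
      then show "f p \<le> 4 * w\<^sup>2" using p(3) by (simp add: f seminorm_def)
      show "(g p)\<^sup>2 \<le> 1/2 * f p"
        unfolding f using cmod_square_le_seminorm[of T S x] p(3) by (simp add: adj g_def p(1) P_def)
    qed
    have "bdd_above (f ` X)" using f_le by (auto intro!: bdd_aboveI)
    then have f_Sup: "f p \<le> Sup (f ` X)" if "p \<in> X" for p using that by (auto intro: cSup_upper)
    have "Sup (f ` X) \<le> 4 * w\<^sup>2" using False f_le by (auto intro!: cSup_least)
    moreover have "w\<^sup>2 \<le> 1/2 * Sup (f ` X)"
    proof -
      obtain p where p: "p \<in> X" using False by blast
      \<comment> \<open>The bound on squares is moved under a root because \<open>w\<close> is the
        supremum of \<open>g\<close> itself.\<close>
      have "w \<le> sqrt (1/2 * Sup (f ` X))"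
        unfolding w_def
      proof (rule cSup_least)
        fix y
        assume "y \<in> g ` X"
        then obtain p where p: "p \<in> X" "y = g p" by blast
        have "(g p)\<^sup>2 \<le> 1/2 * Sup (f ` X)" using g_square[OF p(1)] f_Sup[OF p(1)] by simp
        then show "y \<le> sqrt (1/2 * Sup (f ` X))" unfolding p(2) by (rule real_le_rsqrt)
      qed (use False in simp)
      then have "w\<^sup>2 \<le> (sqrt (1/2 * Sup (f ` X)))\<^sup>2" using w_nonneg by (rule power_mono)
      moreover have "0 \<le> 1/2 * Sup (f ` X)"
        using g_square[OF p] f_Sup[OF p] zero_le_power2[of "g p"] by linarith
      ultimately show ?thesis by (simp only: real_sqrt_pow2)
    qed
    ultimately show ?thesis using False by (simp add: sup0_def w_def)
  qed
  then show ?thesis unfolding omega triple[symmetric] by (simp add: P_def S_def)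
qed

end
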